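(* Let $n\ge1$, $k\in\mathbb N_0$. For $i=0,\dots,k$ define the operators $$\pi_i^k=\sum_{j=0}^{k-i}a_j^{i,k}X_s^{i+j}D_s^{i+j}\in\mathrm{End}(\mathcal P\otimes\mathcal C)$$ with $$a_j^{i,k}=(-1)^j(2n+2k-2i-1)\frac{2^{i+j}}{i!\,j!}\,\frac{(2n+2k-2i-j-2)!}{(2n+2k-i-1)!}.$$ Then for all $i,j\in\{0,\dots,k\}$ and all $M_{k-j}\in\mathcal M_{k-j}$, $$\pi_i^k\big(X_s^jM_{k-j}\big)=\delta_{ij}\,X_s^iM_{k-i}.$$
   Context: $\mathbb N_0=\{0,1,2,\dots\}$. $\mathcal P=\mathbb C[x_1,\dots,x_{2n}]$, with $\mathcal P_l$ its subspace of homogeneous polynomials of degree $l$. The Segal-Shale-Weil module is $\mathcal C=\mathbb C[q_1,\dots,q_n]$, on which the vectors $e_1,f_1,\dots,e_n,f_n$ of a symplectic basis of $\mathbb R^{2n}$ act as operators with $[e_i,e_j]=[f_i,f_j]=0$, $e_if_j-f_je_i=\delta_{ij}$; concretely $e_j=\sqrt{-1}\,q_j$ and $f_j=\sqrt{-1}\,\partial_{q_j}$. On $\mathcal P\otimes\mathcal C$ define $$X_s=\sum_{j=1}^n(x_{2j-1}f_j+x_{2j}e_j),\quad D_s=\sum_{j=1}^n(\partial_{x_{2j-1}}e_j-\partial_{x_{2j}}f_j),\quad \mathbb E=\sum_{j=1}^{2n}x_j\partial_{x_j},$$ where $D_s$ is the symplectic Dirac operator. They satisfy $[\mathbb E,D_s]=-D_s$,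 $[\mathbb E,X_s]=X_s$, $[D_s,X_s]=\mathbb E+n$. The space of symplectic monogenics of degree $l$ is $\mathcal M_l=\mathrm{Ker}(D_s)\cap(\mathcal P_l\otimes\mathcal C)$. $\delta_{ij}$ is the Kronecker delta. *)

theory Defs
  imports Complex_Main "HOL-Library.Poly_Mapping" "HOL-Library.Product_Plus"
begin

text \<open>
  A polynomial is a finitely supported function from monomials to \<^typ>\<open>complex\<close>; a monomial is its
  exponent vector. Variables are indexed by \<^typ>\<open>nat\<close>, and the indices \<open>1, ..., N\<close> are singled out
  by \<open>polys N\<close> below.
\<close>

type_synonym monom = "nat \<Rightarrow>\<^sub>0 nat"
type_synonym cpoly = "monom \<Rightarrow>\<^sub>0 complex"

abbreviation lookup where "lookup \<equiv> Poly_Mapping.lookup"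
abbreviation keys where "keys \<equiv> Poly_Mapping.keys"
abbreviation single where "single \<equiv> Poly_Mapping.single"

definition scal :: "complex \<Rightarrow> ('a \<Rightarrow>\<^sub>0 complex) \<Rightarrow> ('a \<Rightarrow>\<^sub>0 complex)"
  where "scal a F = Poly_Mapping.map (\<lambda>z. a * z) F"

lemma lookup_scal [simp]: "lookup (scal a F) m = a * lookup F m"
  by (simp add: scal_def Poly_Mapping.map.rep_eq when_def)

lemma scal_single: "scal a (single t b) = single t (a * b)"
  by (rule poly_mapping_eqI) (simp add: lookup_single when_def)

global_interpretation cvec: vector_space scal
  by standard (auto intro!: poly_mapping_eqI simp: lookup_add algebra_simps)

definition polys :: "nat \<Rightarrow> cpoly set"
  where "polys N = {p. \<forall>m\<in>keys p. keys m \<subseteq> {1..N}}"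

definition homogeneous_polys :: "nat \<Rightarrow> nat \<Rightarrow> cpoly set"
  where "homogeneous_polys N l = {p \<in> polys N. \<forall>m\<in>keys p. (\<Sum>v\<in>keys m. lookup m v) = l}"

definition mult_var :: "nat \<Rightarrow> cpoly \<Rightarrow> cpoly"
  where "mult_var v p = single (single v 1) 1 * p"

text \<open>When \<open>v\<close> does not occur in \<open>m\<close> the subtraction of exponents is truncated, but the coefficient
  of that summand is then \<open>0\<close>.\<close>

definition partial :: "nat \<Rightarrow> cpoly \<Rightarrow> cpoly"
  where "partial v p =
    (\<Sum>m\<in>keys p. single (m - single v 1) (lookup p m * of_nat (lookup m v)))"

text \<open>
  The pairs \<open>(m, d)\<close> stand for the basis vectors \<open>x\<^sup>m \<otimes> q\<^sup>d\<close> of the tensor product, so an element of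
  the tensor product is a finitely supported function on such pairs.
\<close>

type_synonym ctensor = "(monom \<times> monom) \<Rightarrow>\<^sub>0 complex"

definition tensor :: "cpoly \<Rightarrow> cpoly \<Rightarrow> ctensor"
  where "tensor p c =
    (\<Sum>m\<in>keys p. \<Sum>d\<in>keys c. single (m, d) (lookup p m * lookup c d))"

definition tensor_space :: "cpoly set \<Rightarrow> cpoly set \<Rightarrow> ctensor set"
  where "tensor_space U V = cvec.span {tensor p c | p c. p \<in> U \<and> c \<in> V}"

text \<open>\<open>tensor_op A B\<close> is \<open>A \<otimes> B\<close> for linear \<open>A\<close> and \<open>B\<close>, see \<open>tensor_op_tensor\<close> below.\<close>

definition tensor_op :: "(cpoly \<Rightarrow> cpoly) \<Rightarrow> (cpoly \<Rightarrow> cpoly) \<Rightarrow> ctensor \<Rightarrow> ctensor"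
  where "tensor_op A B F =
    (\<Sum>t\<in>keys F. scal (lookup F t)
      (tensor (A (single (fst t) 1)) (B (single (snd t) 1))))"

definition sp_e :: "nat \<Rightarrow> cpoly \<Rightarrow> cpoly"
  where "sp_e j c = scal \<i> (mult_var j c)"

definition sp_f :: "nat \<Rightarrow> cpoly \<Rightarrow> cpoly"
  where "sp_f j c = scal \<i> (partial j c)"

definition Xs :: "nat \<Rightarrow> ctensor \<Rightarrow> ctensor"
  where "Xs n F = (\<Sum>j=1..n. tensor_op (mult_var (2*j-1)) (sp_f j) F + tensor_op (mult_var (2*j)) (sp_e j) F)"

definition Ds :: "nat \<Rightarrow> ctensor \<Rightarrow> ctensor"
  where "Ds n F = (\<Sum>j=1..n. tensor_op (partial (2*j-1)) (sp_e j) F - tensor_op (partial (2*j)) (sp_f j) F)"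

definition monogenics :: "nat \<Rightarrow> nat \<Rightarrow> ctensor set"
  where "monogenics n l = {F \<in> tensor_space (homogeneous_polys (2*n) l) (polys n). Ds n F = 0}"

text \<open>For \<open>n \<ge> 1\<close>, \<open>i \<le> k\<close> and \<open>j \<le> k - i\<close> none of the natural-number subtractions truncates.\<close>

definition a_coeff :: "nat \<Rightarrow> nat \<Rightarrow> nat \<Rightarrow> nat \<Rightarrow> complex"
  where "a_coeff n i k j =
    (-1) ^ j * of_nat (2*n + 2*k - 2*i - 1) * (2 ^ (i + j) / (fact i * fact j)) *
    (fact (2*n + 2*k - 2*i - j - 2) / fact (2*n + 2*k - i - 1))"

definition pi_op :: "nat \<Rightarrow> nat \<Rightarrow> nat \<Rightarrow> ctensor \<Rightarrow> ctensor"
  where "pi_op n i k F =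
    (\<Sum>j=0..k - i. scal (a_coeff n i k j) ((Xs n ^^ (i + j)) ((Ds n ^^ (i + j)) F)))"


subsection \<open>Well-definedness\<close>

text \<open>\<open>tensor\<close> is bilinear, \<open>tensor_op A B\<close> is \<open>A \<otimes> B\<close>, and the operators are endomorphisms of
  \<open>tensor_space (polys (2*n)) (polys n)\<close>.\<close>

abbreviation clin :: "(('a \<Rightarrow>\<^sub>0 complex) \<Rightarrow> ('b \<Rightarrow>\<^sub>0 complex)) \<Rightarrow> bool"
  where "clin \<equiv> Vector_Spaces.linear scal scal"

lemma clinI:
  assumes "\<And>F G. A (F + G) = A F + A G" "\<And>c F. A (scal c F) = scal c (A F)"
  shows "clin A"
  by (simp add: Vector_Spaces.linear_iff cvec.vector_space_axioms assms)

lemma clin_add: "clin A \<Longrightarrow> A (F + G) = A F + A G"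
  and clin_scal: "clin A \<Longrightarrow> A (scal c F) = scal c (A F)"
  by (simp_all add: Vector_Spaces.linear_iff)

lemma clin_0: "clin A \<Longrightarrow> A 0 = 0"
  using clin_scal[of A 0 0] by simp

lemma clin_sum: "clin A \<Longrightarrow> A (sum g S) = (\<Sum>s\<in>S. A (g s))"
  by (induction S rule: infinite_finite_induct) (simp_all add: clin_0 clin_add)

lemma clin_pow: "clin A \<Longrightarrow> clin (A ^^ r)" for A :: "('a \<Rightarrow>\<^sub>0 complex) \<Rightarrow> ('a \<Rightarrow>\<^sub>0 complex)"
proof (induction r)
  case 0 show ?case by (intro clinI) auto
next
  case (Suc r) then show ?case
    by (intro clinI) (auto simp: clin_add clin_scal)
qed

lemma lookup_tensor: "lookup (tensor p c) (m, d) = lookup p m * lookup c d"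
proof -
  have *: "(lookup p m' * lookup c d' when (m', d') = (m, d)) =
      (if m' = m then if d' = d then lookup p m * lookup c d else 0 else 0)" for m' d'
    by (simp add: when_def)
  have if_out: "(\<Sum>d'\<in>keys c. if b then g d' else 0) = (if b then \<Sum>d'\<in>keys c. g d' else 0)"
    for b and g :: "monom \<Rightarrow> complex"
    by simp
  show ?thesis
    unfolding tensor_def lookup_sum lookup_single * if_out
    by (simp only: sum.delta finite_keys) (simp add: in_keys_iff)
qed

lemma tensor_add_left: "tensor (p + p') c = tensor p c + tensor p' c"
  and tensor_add_right: "tensor p (c + c') = tensor p c + tensor p c'"
  and tensor_scal_left: "tensor (scal a p) c = scal a (tensor p c)"
  and tensor_scal_right: "tensor p (scal a c) = scal a (tensor p c)"
  by (rule poly_mapping_eqI, clarsimp simp: lookup_tensor lookup_add algebra_simps)+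

lemma clin_tensor: "clin (\<lambda>p. tensor p c)" "clin (tensor p)"
  by (intro clinI; simp add: tensor_add_left tensor_add_right tensor_scal_left tensor_scal_right)+

lemma expand_basis: "F = (\<Sum>t\<in>keys F. scal (lookup F t) (single t 1))"
proof (rule poly_mapping_eqI)
  fix k
  show "lookup F k = lookup (\<Sum>t\<in>keys F. scal (lookup F t) (single t 1)) k"
    by (simp add: lookup_sum lookup_single when_def in_keys_iff if_distrib sum.delta cong: if_cong)
qed

lemma sum_keys_superset:
  assumes "finite S" "keys F \<subseteq> S"
  shows "(\<Sum>t\<in>keys F. scal (lookup F t) (g t)) = (\<Sum>t\<in>S. scal (lookup F t) (g t))"
  by (rule sum.mono_neutral_left) (use assms in \<open>auto simp: in_keys_iff\<close>)

lemma clin_extend: "clin (\<lambda>F. \<Sum>t\<in>keys F. scal (lookup F t) (g t))"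
proof (rule clinI)
  fix F G :: "'a \<Rightarrow>\<^sub>0 complex" and c
  let ?S = "keys F \<union> keys G"
  have "keys (F + G) \<subseteq> ?S" by (rule Poly_Mapping.keys_add)
  then show "(\<Sum>t\<in>keys (F + G). scal (lookup (F + G) t) (g t)) =
     (\<Sum>t\<in>keys F. scal (lookup F t) (g t)) + (\<Sum>t\<in>keys G. scal (lookup G t) (g t))"
    by (subst (1 2 3) sum_keys_superset[of ?S])
      (auto simp: lookup_add cvec.scale_left_distrib sum.distrib)
  have "keys (scal c F) \<subseteq> keys F" by (auto simp: in_keys_iff)
  then show "(\<Sum>t\<in>keys (scal c F). scal (lookup (scal c F) t) (g t)) =
     scal c (\<Sum>t\<in>keys F. scal (lookup F t) (g t))"
    by (subst sum_keys_superset[of "keys F"]) (auto simp: cvec.scale_sum_right)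
qed

lemma clin_tensor_op: "clin (tensor_op A B)"
  using clin_extend unfolding tensor_op_def .

lemma tensor_op_tensor:
  assumes "clin A" "clin B"
  shows "tensor_op A B (tensor p c) = tensor (A p) (B c)"
proof -
  have unit: "tensor (single m 1) (single d 1) = single (m, d) 1"
    for m d by (simp add: tensor_def)
  have basis: "tensor_op A B (tensor (single m 1) (single d 1)) =
      tensor (A (single m 1)) (B (single d 1))" for m d
    unfolding unit by (simp add: tensor_op_def)
  have "tensor_op A B (tensor (\<Sum>m\<in>keys p. scal (lookup p m) (single m 1))
          (\<Sum>d\<in>keys c. scal (lookup c d) (single d 1))) =
        tensor (A (\<Sum>m\<in>keys p. scal (lookup p m) (single m 1)))
          (B (\<Sum>d\<in>keys c. scal (lookup c d) (single d 1)))"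
    by (simp add: clin_sum[OF clin_tensor(1)] clin_sum[OF clin_tensor(2)] clin_sum[OF assms(1)]
        clin_sum[OF assms(2)] clin_sum[OF clin_tensor_op] clin_scal[OF assms(1)] clin_scal[OF assms(2)]
        clin_scal[OF clin_tensor_op] tensor_scal_left tensor_scal_right basis del: cvec.scale_scale)
  then show ?thesis
    by (simp flip: expand_basis)
qed

lemma clin_mult_var: "clin (mult_var v)"
  unfolding mult_var_def
proof (rule clinI)
  fix c and F :: cpoly
  have *: "scal c F = single 0 c * F" for c and F :: cpoly
    by (simp add: scal_def mult_map_scale_conv_mult)
  show "single (single v 1) 1 * scal c F =
     scal c (single (single v 1) 1 * F)"
    unfolding * by (simp add: mult.left_commute)
qed (simp add: distrib_left)

lemma clin_partial: "clin (partial v)"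
proof -
  have *: "partial v = (\<lambda>p. \<Sum>m\<in>keys p. scal (lookup p m)
      (single (m - single v 1) (of_nat (lookup m v))))"
    unfolding partial_def by (simp add: scal_single)
  show ?thesis unfolding * by (rule clin_extend)
qed

lemma clin_sp_e: "clin (sp_e j)" and clin_sp_f: "clin (sp_f j)"
  unfolding sp_e_def sp_f_def
  by (intro clinI; simp add: clin_add[OF clin_mult_var] clin_add[OF clin_partial]
      clin_scal[OF clin_mult_var] clin_scal[OF clin_partial] cvec.scale_right_distrib mult.commute)+

lemma clin_Xs: "clin (Xs n)" and clin_Ds: "clin (Ds n)"
  unfolding Xs_def Ds_def
  by (intro clinI; simp add: clin_add[OF clin_tensor_op] clin_scal[OF clin_tensor_op]
      cvec.scale_sum_right cvec.scale_right_distrib cvec.scale_right_diff_distrib sum.distrib sum_subtractf algebra_simps)+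

lemma clin_pi_op: "clin (pi_op n i k)"
  unfolding pi_op_def
  by (intro clinI; simp add: clin_add[OF clin_pow[OF clin_Xs]] clin_scal[OF clin_pow[OF clin_Xs]]
      clin_add[OF clin_pow[OF clin_Ds]] clin_scal[OF clin_pow[OF clin_Ds]]
      cvec.scale_sum_right cvec.scale_right_distrib sum.distrib mult.commute)

lemma polys_subspace: "cvec.subspace (polys N)"
proof (rule cvec.subspaceI)
  fix p q assume "p \<in> polys N" "q \<in> polys N"
  then show "p + q \<in> polys N"
    using Poly_Mapping.keys_add[of p q] by (fastforce simp: polys_def)
next
  fix c p assume "p \<in> polys N"
  then show "scal c p \<in> polys N" by (auto simp: polys_def in_keys_iff)
qed (simp add: polys_def)

lemma mult_var_polys:
  assumes "p \<in> polys N" "v \<in> {1..N}"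
  shows "mult_var v p \<in> polys N"
  unfolding polys_def mult_var_def
proof (intro CollectI ballI)
  fix m assume "m \<in> keys (single (single v 1) 1 * p)"
  then obtain m' where m': "m = single v 1 + m'" "m' \<in> keys p"
    using keys_mult[of "single (single v 1) (1::complex)" p] by auto
  have "keys m \<subseteq> insert v (keys m')"
    unfolding m'(1) using Poly_Mapping.keys_add[of "single v (1::nat)" m'] by auto
  then show "keys m \<subseteq> {1..N}"
    using assms m'(2) unfolding polys_def by blast
qed

lemma partial_polys:
  assumes "p \<in> polys N" shows "partial v p \<in> polys N"
  unfolding partial_def
proof (rule cvec.subspace_sum[OF polys_subspace])
  fix m assume m: "m \<in> keys p"
  have "keys (m - single v 1) \<subseteq> keys m"
    by (auto simp: in_keys_iff lookup_minus)
  with m show "single (m - single v 1) (lookup p m * of_nat (lookup m v)) \<in> polys N"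
    using assms by (fastforce simp: polys_def)
qed

lemma tensor_op_tensor_space:
  assumes "clin A" "clin B" "\<And>p. p \<in> U \<Longrightarrow> A p \<in> U'" "\<And>c. c \<in> V \<Longrightarrow> B c \<in> V'"
    and "F \<in> tensor_space U V"
  shows "tensor_op A B F \<in> tensor_space U' V'"
  using assms(5) unfolding tensor_space_def
proof (induction rule: cvec.span_induct_alt)
  case base then show ?case by (simp add: clin_0[OF clin_tensor_op] cvec.span_zero)
next
  case (step c x y)
  then obtain p d where "x = tensor p d" "p \<in> U" "d \<in> V" by auto
  then have "tensor_op A B x \<in> cvec.span {tensor p c |p c. p \<in> U' \<and> c \<in> V'}"
    using assms(3,4) by (intro cvec.span_base) (auto simp: tensor_op_tensor assms(1,2))
  with step show ?case
    by (simp add: clin_add[OF clin_tensor_op] clin_scal[OF clin_tensor_op] cvec.span_add cvec.span_scale)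
qed

lemma Xs_tensor_space:
  assumes "F \<in> tensor_space (polys (2*n)) (polys n)"
  shows "Xs n F \<in> tensor_space (polys (2*n)) (polys n)"
proof -
  have "tensor_op (mult_var (2*j-1)) (sp_f j) F + tensor_op (mult_var (2*j)) (sp_e j) F
      \<in> tensor_space (polys (2*n)) (polys n)" if j: "j \<in> {1..n}" for j
    unfolding tensor_space_def
    by (rule cvec.span_add; fold tensor_space_def;
        rule tensor_op_tensor_space[OF clin_mult_var _ _ _ assms])
      (use j in \<open>auto simp: clin_sp_e clin_sp_f sp_e_def sp_f_def
          intro!: mult_var_polys partial_polys cvec.subspace_scale[OF polys_subspace]\<close>)
  then show ?thesis
    unfolding Xs_def tensor_space_def by (intro cvec.span_sum)
qed

lemma Ds_tensor_space:
  assumes "F \<in> tensor_space (polys (2*n)) (polys n)"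
  shows "Ds n F \<in> tensor_space (polys (2*n)) (polys n)"
proof -
  have "tensor_op (partial (2*j-1)) (sp_e j) F - tensor_op (partial (2*j)) (sp_f j) F
      \<in> tensor_space (polys (2*n)) (polys n)" if j: "j \<in> {1..n}" for j
    unfolding tensor_space_def
    by (rule cvec.span_diff; fold tensor_space_def;
        rule tensor_op_tensor_space[OF clin_partial _ _ _ assms])
      (use j in \<open>auto simp: clin_sp_e clin_sp_f sp_e_def sp_f_def
          intro!: mult_var_polys partial_polys cvec.subspace_scale[OF polys_subspace]\<close>)
  then show ?thesis
    unfolding Ds_def tensor_space_def by (intro cvec.span_sum)
qed

lemma pi_op_tensor_space:
  assumes "F \<in> tensor_space (polys (2*n)) (polys n)"
  shows "pi_op n i k F \<in> tensor_space (polys (2*n)) (polys n)"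
proof -
  have D: "(Ds n ^^ r) F \<in> tensor_space (polys (2*n)) (polys n)" for r
    by (induction r) (auto intro: assms Ds_tensor_space)
  have "(Xs n ^^ s) ((Ds n ^^ r) F) \<in> tensor_space (polys (2*n)) (polys n)" for r s
    by (induction s) (auto intro: D Xs_tensor_space)
  then show ?thesis
    unfolding pi_op_def tensor_space_def by (intro cvec.span_sum cvec.span_scale)
qed

end

(*
  The operators Xs and Ds generate a copy of sl(2): the commutator [Ds, Xs] is the Euler operator
  plus n.  Hence Ds lowers the power of Xs in Xs^j M, for M monogenic of degree l, with the factor
  j (2 l + 2 n + j - 1) / 2.  With d = j - i this turns pi_i^k (Xs^j M) into a multiple of
  sum_t (-1)^t (d choose t) (2 n + 2 k - 2 i - 2 - t choose d - 1) for d > 0, which vanishes as the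
  d-th finite difference of a polynomial of degree d - 1.
*)
theory Submission
  imports Defs
begin

section \<open>The Weyl algebra relations\<close>

lemma clin_compose:
  assumes "clin A" "clin B"
  shows "clin (\<lambda>F. A (B F))"
  by (intro clinI) (simp_all only: clin_add[OF assms(1)] clin_add[OF assms(2)]
      clin_scal[OF assms(1)] clin_scal[OF assms(2)])

lemma clin_plus:
  assumes "clin A" "clin B"
  shows "clin (\<lambda>F. A F + B F)"
  by (intro clinI) (simp_all only: clin_add[OF assms(1)] clin_add[OF assms(2)]
      clin_scal[OF assms(1)] clin_scal[OF assms(2)] cvec.scale_right_distrib ac_simps)

lemma clin_diff:
  assumes "clin A"
  shows "A (F - G) = A F - A G"
  using clin_add[OF assms, of "F - G" G] by simp

text \<open>Expanding \<open>F\<close> in basis vectors and pushing both maps through the finite sum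
  reduces operator identities to monomials.\<close>

lemma clin_eqI:
  assumes "clin A" "clin B" "\<And>m. A (single m 1) = B (single m 1)"
  shows "A F = B F"
proof -
  have "A (\<Sum>t\<in>keys F. scal (lookup F t) (single t 1)) = B (\<Sum>t\<in>keys F. scal (lookup F t) (single t 1))"
    by (simp only: clin_sum[OF assms(1)] clin_sum[OF assms(2)] clin_scal[OF assms(1)]
        clin_scal[OF assms(2)] assms(3))
  then show ?thesis
    by (simp flip: expand_basis)
qed

lemma mult_var_single: "mult_var v (single m a) = single (single v 1 + m) a"
  by (simp add: mult_var_def mult_single)

lemma partial_single: "partial v (single m a) = single (m - single v 1) (a * of_nat (lookup m v))"
  by (simp add: partial_def)

lemma mult_var_commute: "mult_var v (mult_var w p) = mult_var w (mult_var v p)"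
  by (simp add: mult_var_def mult.left_commute)

lemma partial_commute: "partial v (partial w p) = partial w (partial v p)"
proof (rule clin_eqI[of "\<lambda>p. partial v (partial w p)" "\<lambda>p. partial w (partial v p)"])
  fix m :: monom
  have "m - single w 1 - single v 1 = m - single v 1 - single w (1::nat)"
    by (rule poly_mapping_eqI) (simp add: lookup_minus)
  then show "partial v (partial w (single m 1)) = partial w (partial v (single m 1))"
    by (cases "v = w") (simp_all add: partial_single lookup_minus lookup_single when_def mult.commute)
qed (rule clin_compose[OF clin_partial clin_partial])+

text \<open>The Weyl relation, checked on monomials: the exponent of the variable \<open>v\<close>
  contributes one more after multiplication by that variable, and this is the extra summand.\<close>

lemma partial_mult_var:
  "partial v (mult_var w p) = mult_var w (partial v p) + (if v = w then p else 0)"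
proof (rule clin_eqI[of "\<lambda>p. partial v (mult_var w p)"
      "\<lambda>p. mult_var w (partial v p) + (if v = w then p else 0)"])
  show "clin (\<lambda>p. mult_var w (partial v p) + (if v = w then p else 0))"
    by (rule clin_plus[OF clin_compose[OF clin_mult_var clin_partial]]) (rule clinI; simp)
  fix m :: monom
  show "partial v (mult_var w (single m 1)) =
      mult_var w (partial v (single m 1)) + (if v = w then single m 1 else 0)"
  proof (cases "v = w")
    case True
    have "single v 1 + m - single v 1 = m"
      by simp
    \<comment> \<open>Lowering and raising an exponent cancel only if it is positive. At exponent 0
      the derivative vanishes, and the added summand accounts for the whole left-hand side.\<close>
    moreover have "single v 1 + (m - single v 1) = m" if "lookup m v \<noteq> 0"
      using that by (intro poly_mapping_eqI) (auto simp: lookup_add lookup_minus lookup_single when_def)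
    ultimately show ?thesis
      using True
      by (cases "lookup m v = 0")
        (simp_all add: mult_var_single partial_single lookup_add clin_0[OF clin_mult_var]
          add.commute single_add[of m, symmetric])
  next
    case False
    then have "single w 1 + (m - single v 1) = single w 1 + m - single v (1::nat)"
      by (intro poly_mapping_eqI) (auto simp: lookup_add lookup_minus lookup_single when_def)
    with False show ?thesis
      by (simp add: mult_var_single partial_single lookup_add lookup_single when_def)
  qed
qed (rule clin_compose[OF clin_partial clin_mult_var])

lemma sp_e_commute: "sp_e j (sp_e l c) = sp_e l (sp_e j c)"
  by (simp add: sp_e_def clin_scal[OF clin_mult_var] mult_var_commute)

lemma sp_f_commute: "sp_f j (sp_f l c) = sp_f l (sp_f j c)"
  by (simp add: sp_f_def clin_scal[OF clin_partial] partial_commute)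

text \<open>Both operators carry the factor \<open>\<i>\<close>, and its square -1 reverses the sign
  in the Weyl relation.\<close>

lemma sp_e_sp_f: "sp_e j (sp_f l c) = sp_f l (sp_e j c) + (if j = l then c else 0)"
  by (auto simp: sp_e_def sp_f_def clin_scal[OF clin_partial] clin_scal[OF clin_mult_var]
      partial_mult_var cvec.scale_right_distrib)

section \<open>Homogeneous components\<close>

text \<open>Each monomial is an eigenvector of this operator, with the exponent of \<open>v\<close>
  as eigenvalue; summed over \<open>v\<close>, this makes the Euler operator diagonal.\<close>

lemma lookup_mult_var_partial: "lookup (mult_var v (partial v p)) m = of_nat (lookup m v) * lookup p m"
proof -
  have "single v 1 + (m' - single v 1) = m'" if "lookup m' v \<noteq> 0" for m' :: monom
    using that by (intro poly_mapping_eqI) (auto simp: lookup_add lookup_minus lookup_single when_def)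
  then have *: "mult_var v (partial v (single m' 1)) = single m' (of_nat (lookup m' v))" for m'
    by (cases "lookup m' v = 0") (simp_all add: partial_single mult_var_single clin_0[OF clin_mult_var])
  have "mult_var v (partial v p) = (\<Sum>t\<in>keys p. scal (lookup p t) (single t (of_nat (lookup t v))))"
    by (rule clin_eqI[of "\<lambda>p. mult_var v (partial v p)", OF clin_compose[OF clin_mult_var clin_partial] clin_extend])
      (simp only: *, simp)
  then show ?thesis
    by (simp add: lookup_sum lookup_single when_def if_distrib in_keys_iff sum.delta cong: if_cong)
qed

lemma euler_homogeneous:
  assumes "p \<in> homogeneous_polys N l"
  shows "(\<Sum>v=1..N. mult_var v (partial v p)) = scal (of_nat l) p"
proof (rule poly_mapping_eqI)
  fix m
  have "(\<Sum>v=1..N. lookup m v) = l" if "m \<in> keys p"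
  proof -
    have "keys m \<subseteq> {1..N}" "(\<Sum>v\<in>keys m. lookup m v) = l"
      using assms that by (auto simp: homogeneous_polys_def polys_def)
    \<comment> \<open>Absent variables have exponent 0, so the total degree may be summed over the
      fixed range \<open>{1..N}\<close>.\<close>
    moreover from this have "(\<Sum>v\<in>keys m. lookup m v) = (\<Sum>v=1..N. lookup m v)"
      by (intro sum.mono_neutral_left) (auto simp: in_keys_iff)
    ultimately show ?thesis by simp
  qed
  then show "lookup (\<Sum>v=1..N. mult_var v (partial v p)) m = lookup (scal (of_nat l) p) m"
    by (cases "m \<in> keys p")
      (auto simp: lookup_sum lookup_mult_var_partial in_keys_iff
        simp flip: sum_distrib_right of_nat_sum)
qed

lemma mult_var_homogeneous:
  assumes "p \<in> homogeneous_polys N l" "v \<in> {1..N}"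
  shows "mult_var v p \<in> homogeneous_polys N (Suc l)"
  unfolding homogeneous_polys_def
proof (intro CollectI conjI ballI)
  show "mult_var v p \<in> polys N"
    using assms by (auto simp: homogeneous_polys_def intro: mult_var_polys)
  fix m assume "m \<in> keys (mult_var v p)"
  then obtain m' where m': "m = single v 1 + m'" "m' \<in> keys p"
    using keys_mult[of "single (single v 1) (1::complex)" p] by (auto simp: mult_var_def)
  \<comment> \<open>The variable \<open>v\<close> may be absent from \<open>m'\<close>; on
    \<open>insert v (keys m')\<close> the exponents of \<open>m\<close> and \<open>m'\<close> can be
    compared termwise.\<close>
  have "(\<Sum>w\<in>keys m. lookup m w) = (\<Sum>w\<in>insert v (keys m'). lookup m w)"
    by (rule sum.mono_neutral_left)
      (auto simp: m' in_keys_iff lookup_add lookup_single when_def split: if_splits)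
  also have "\<dots> = (\<Sum>w\<in>insert v (keys m'). (if w = v then 1 else 0) + lookup m' w)"
    by (rule sum.cong) (auto simp: m' lookup_add lookup_single when_def)
  also have "\<dots> = 1 + (\<Sum>w\<in>insert v (keys m'). lookup m' w)"
    by (subst sum.distrib) simp
  also have "(\<Sum>w\<in>insert v (keys m'). lookup m' w) = (\<Sum>w\<in>keys m'. lookup m' w)"
    by (rule sum.mono_neutral_right) (auto simp: in_keys_iff)
  also have "\<dots> = l"
    using assms m' by (simp add: homogeneous_polys_def)
  finally show "(\<Sum>w\<in>keys m. lookup m w) = Suc l" by simp
qed

lemma sp_e_polys: "c \<in> polys n \<Longrightarrow> j \<in> {1..n} \<Longrightarrow> sp_e j c \<in> polys n"
  unfolding sp_e_def by (intro cvec.subspace_scale[OF polys_subspace] mult_var_polys)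

lemma sp_f_polys: "c \<in> polys n \<Longrightarrow> sp_f j c \<in> polys n"
  unfolding sp_f_def by (intro cvec.subspace_scale[OF polys_subspace] partial_polys)

lemma Xs_homogeneous:
  assumes "F \<in> tensor_space (homogeneous_polys (2*n) l) (polys n)"
  shows "Xs n F \<in> tensor_space (homogeneous_polys (2*n) (Suc l)) (polys n)"
  unfolding Xs_def tensor_space_def
proof (intro cvec.span_sum cvec.span_add; fold tensor_space_def)
  fix j assume j: "j \<in> {1..n}"
  show "tensor_op (mult_var (2*j-1)) (sp_f j) F
      \<in> tensor_space (homogeneous_polys (2*n) (Suc l)) (polys n)"
    by (rule tensor_op_tensor_space[OF clin_mult_var clin_sp_f mult_var_homogeneous sp_f_polys assms])
      (use j in auto)
  show "tensor_op (mult_var (2*j)) (sp_e j) F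
      \<in> tensor_space (homogeneous_polys (2*n) (Suc l)) (polys n)"
    by (rule tensor_op_tensor_space[OF clin_mult_var clin_sp_e mult_var_homogeneous sp_e_polys assms])
      (use j in auto)
qed

text \<open>Tracks the degree along powers of \<open>Xs\<close>, on which the Euler operator in the
  commutator then acts as a known scalar.\<close>

lemma Xs_pow_homogeneous:
  assumes "F \<in> tensor_space (homogeneous_polys (2*n) l) (polys n)"
  shows "(Xs n ^^ r) F \<in> tensor_space (homogeneous_polys (2*n) (l + r)) (polys n)"
  by (induction r) (simp_all add: assms Xs_homogeneous)

section \<open>The commutator of \<open>Ds\<close> and \<open>Xs\<close>\<close>

lemma sum_pairs: "(\<Sum>j=1..n. g (2*j-1) + g (2*j)) = (\<Sum>v=1..2*n. g v)"
  for g :: "nat \<Rightarrow> 'a :: comm_monoid_add"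
  by (induction n) (simp_all add: add.assoc)

lemma Xs_tensor:
  "Xs n (tensor p c) =
    (\<Sum>j=1..n. tensor (mult_var (2*j-1) p) (sp_f j c) + tensor (mult_var (2*j) p) (sp_e j c))"
  by (simp add: Xs_def tensor_op_tensor clin_mult_var clin_sp_e clin_sp_f)

lemma Ds_tensor:
  "Ds n (tensor p c) =
    (\<Sum>j=1..n. tensor (partial (2*j-1) p) (sp_e j c) - tensor (partial (2*j) p) (sp_f j c))"
  by (simp add: Ds_def tensor_op_tensor clin_partial clin_sp_e clin_sp_f)

lemma tensor_0: "tensor 0 c = 0" "tensor p 0 = 0"
  by (simp_all add: tensor_def)

text \<open>Only pairs with equal indices fail to commute. For index \<open>j\<close>, the terms in
  the odd variable leave its Euler term plus \<open>f_j e_j + 1\<close>, those in the even variable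
  leave its Euler term minus \<open>f_j e_j\<close>. Summation gives the degree \<open>l\<close>
  from the Euler terms and \<open>n\<close> from the units.\<close>

lemma Ds_Xs_tensor:
  assumes "p \<in> homogeneous_polys (2*n) l"
  shows "Ds n (Xs n (tensor p c)) = Xs n (Ds n (tensor p c)) + scal (of_nat (l + n)) (tensor p c)"
proof -
  let ?dx = "\<lambda>j r. tensor (partial (2*j-1) (mult_var (2*r-1) p)) (sp_e j (sp_f r c))
      - tensor (partial (2*j) (mult_var (2*r-1) p)) (sp_f j (sp_f r c))
      + (tensor (partial (2*j-1) (mult_var (2*r) p)) (sp_e j (sp_e r c))
      - tensor (partial (2*j) (mult_var (2*r) p)) (sp_f j (sp_e r c)))"
  let ?xd = "\<lambda>j r. tensor (mult_var (2*r-1) (partial (2*j-1) p)) (sp_f r (sp_e j c))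
      + tensor (mult_var (2*r) (partial (2*j-1) p)) (sp_e r (sp_e j c))
      - (tensor (mult_var (2*r-1) (partial (2*j) p)) (sp_f r (sp_f j c))
      + tensor (mult_var (2*r) (partial (2*j) p)) (sp_e r (sp_f j c)))"
  let ?E = "\<lambda>j. tensor (mult_var (2*j-1) (partial (2*j-1) p)) c
      + tensor (mult_var (2*j) (partial (2*j) p)) c"
  have comm: "?dx j r = ?xd j r + (if j = r then ?E j + tensor p c else 0)"
    if jr: "j \<in> {1..n}" "r \<in> {1..n}" for j r
  proof -
    \<comment> \<open>Positivity of \<open>j\<close> and \<open>r\<close> matters: at index 0
      truncation would make \<open>2*j-1\<close> and \<open>2*j\<close> the same variable.\<close>
    have ne: "2*j-1 \<noteq> 2*r" "2*j \<noteq> 2*r-1" "2*j-1 = 2*r-1 \<longleftrightarrow> j = r" "2*j = 2*r \<longleftrightarrow> j = r"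
      using jr by (auto, presburger+)
    show ?thesis
    proof (cases "j = r")
      case True
      then show ?thesis
        using ne
        by (simp add: partial_mult_var sp_e_sp_f tensor_add_left tensor_add_right tensor_0
          sp_e_commute sp_f_commute algebra_simps)
    next
      case False
      then show ?thesis
        using ne
        by (simp add: partial_mult_var sp_e_sp_f tensor_add_left tensor_add_right tensor_0
          sp_e_commute[of j r] sp_f_commute[of j r] algebra_simps)
    qed
  qed
  have "Ds n (Xs n (tensor p c)) = (\<Sum>r=1..n. \<Sum>j=1..n. ?dx j r)"
    by (simp only: Xs_tensor clin_sum[OF clin_Ds] clin_add[OF clin_Ds] Ds_tensor sum.distrib)
  \<comment> \<open>Applying \<open>Xs\<close> first puts its index \<open>r\<close> outside; the
    swap matches the order arising from \<open>Xs n (Ds n _)\<close>.\<close>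
  also have "\<dots> = (\<Sum>j=1..n. \<Sum>r=1..n. ?dx j r)"
    by (rule sum.swap)
  also have "\<dots> = (\<Sum>j=1..n. \<Sum>r=1..n. ?xd j r + (if j = r then ?E j + tensor p c else 0))"
    by (intro sum.cong refl comm)
  also have "\<dots> = (\<Sum>j=1..n. \<Sum>r=1..n. ?xd j r) + (\<Sum>j=1..n. ?E j + tensor p c)"
    by (simp add: sum.distrib sum.delta' del: sum.cl_ivl_Suc)
  also have "(\<Sum>j=1..n. \<Sum>r=1..n. ?xd j r) = Xs n (Ds n (tensor p c))"
    by (simp only: Ds_tensor clin_sum[OF clin_Xs] clin_diff[OF clin_Xs] Xs_tensor sum_subtractf)
  also have "(\<Sum>j=1..n. ?E j + tensor p c) =
      (\<Sum>v=1..2*n. tensor (mult_var v (partial v p)) c) + scal (of_nat n) (tensor p c)"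
  proof -
    have "(\<Sum>j=1..n. tensor p c) = scal (of_nat n) (tensor p c)"
      by (simp only: cvec.sum_constant_scale card_atLeastAtMost diff_Suc_1)
    then show ?thesis
      by (simp only: sum.distrib[of ?E] sum_pairs[of "\<lambda>v. tensor (mult_var v (partial v p)) c"])
  qed
  also have "(\<Sum>v=1..2*n. tensor (mult_var v (partial v p)) c) = scal (of_nat l) (tensor p c)"
    by (simp only: clin_sum[OF clin_tensor(1), symmetric] euler_homogeneous[OF assms] tensor_scal_left)
  finally show ?thesis
    by (simp add: cvec.scale_left_distrib)
qed

lemma Ds_Xs_homogeneous:
  assumes "F \<in> tensor_space (homogeneous_polys (2*n) l) (polys n)"
  shows "Ds n (Xs n F) = Xs n (Ds n F) + scal (of_nat (l + n)) F"
  using assms unfolding tensor_space_def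
proof (induction rule: cvec.span_induct_alt)
  case base
  show ?case by (simp add: clin_0[OF clin_Xs] clin_0[OF clin_Ds])
next
  case (step a x y)
  then obtain p c where "x = tensor p c" "p \<in> homogeneous_polys (2*n) l" by auto
  then have "Ds n (Xs n x) = Xs n (Ds n x) + scal (of_nat (l + n)) x"
    by (simp only: Ds_Xs_tensor)
  with step.IH show ?case
    by (simp only: clin_add[OF clin_Xs] clin_add[OF clin_Ds] clin_scal[OF clin_Xs]
        clin_scal[OF clin_Ds] cvec.scale_right_distrib cvec.scale_left_commute[of a] ac_simps)
qed

section \<open>Action on the Fischer components\<close>

text \<open>Moving \<open>Ds\<close> past one factor \<open>Xs\<close> at a time collects the
  scalars \<open>l + n + s\<close> for \<open>s = 0, ..., r\<close>, whose sum is the stated factor;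
  the last term vanishes because \<open>Ds\<close> kills \<open>M\<close>.\<close>

lemma Ds_Xs_Suc_pow:
  assumes "M \<in> monogenics n l"
  shows "Ds n ((Xs n ^^ Suc r) M) =
    scal (of_nat (Suc r) * of_nat (2*l + 2*n + r) / 2) ((Xs n ^^ r) M)"
proof (induction r)
  case 0
  have "of_nat (Suc 0) * of_nat (2*l + 2*n + 0) / 2 = (of_nat (l + n) :: complex)"
    by (simp add: field_simps)
  then show ?case
    using assms Ds_Xs_homogeneous[of M n l]
    by (simp only:) (simp add: monogenics_def clin_0[OF clin_Xs])
next
  case (Suc r)
  have "Ds n ((Xs n ^^ Suc (Suc r)) M) =
      Xs n (Ds n ((Xs n ^^ Suc r) M)) + scal (of_nat (l + Suc r + n)) ((Xs n ^^ Suc r) M)"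
    using assms Ds_Xs_homogeneous[OF Xs_pow_homogeneous[of M n l "Suc r"]]
    by (simp add: monogenics_def)
  also have "\<dots> = scal (of_nat (Suc r) * of_nat (2*l + 2*n + r) / 2 + of_nat (l + Suc r + n))
      ((Xs n ^^ Suc r) M)"
    unfolding Suc by (simp only: clin_scal[OF clin_Xs] cvec.scale_left_distrib funpow.simps o_apply)
  also have "of_nat (Suc r) * of_nat (2*l + 2*n + r) / 2 + of_nat (l + Suc r + n) =
      (of_nat (Suc (Suc r)) * of_nat (2*l + 2*n + Suc r) / 2 :: complex)"
    by (simp add: field_simps)
  finally show ?case .
qed

text \<open>The factors \<open>m * (2*l + 2*n + m - 1) / 2\<close> for
  \<open>m = r + 1, ..., r + s\<close> are multiplied, and each of the two products of consecutive
  numbers is a quotient of factorials.\<close>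

lemma Ds_pow_Xs_pow:
  assumes "M \<in> monogenics n l" "n \<ge> 1"
  shows "(Ds n ^^ s) ((Xs n ^^ (s + r)) M) =
    scal (fact (s + r) / fact r * (fact (2*l + 2*n - 1 + s + r) / fact (2*l + 2*n - 1 + r)) / 2 ^ s)
      ((Xs n ^^ r) M)"
proof (induction s)
  case (Suc s)
  \<comment> \<open>Since \<open>n\<close> is positive, \<open>2*l + 2*n - 1\<close> is a genuine
    predecessor, as the factorial recursion requires.\<close>
  obtain b where b: "2*l + 2*n = Suc b"
    using assms(2) by (cases "2*l + 2*n") auto
  have "(Ds n ^^ Suc s) ((Xs n ^^ (Suc s + r)) M) = (Ds n ^^ s) (Ds n ((Xs n ^^ Suc (s + r)) M))"
    by (simp only: funpow_Suc_right o_apply add_Suc)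
  also have "\<dots> = scal (of_nat (Suc (s + r)) * of_nat (2*l + 2*n + (s + r)) / 2)
      ((Ds n ^^ s) ((Xs n ^^ (s + r)) M))"
    by (simp only: Ds_Xs_Suc_pow[OF assms(1)] clin_scal[OF clin_pow[OF clin_Ds]])
  also have "\<dots> = scal (of_nat (Suc (s + r)) * of_nat (2*l + 2*n + (s + r)) / 2 *
      (fact (s + r) / fact r * (fact (2*l + 2*n - 1 + s + r) / fact (2*l + 2*n - 1 + r)) / 2 ^ s))
      ((Xs n ^^ r) M)"
    by (simp only: Suc.IH cvec.scale_scale)
  also have "of_nat (Suc (s + r)) * of_nat (2*l + 2*n + (s + r)) / 2 *
      (fact (s + r) / fact r * (fact (2*l + 2*n - 1 + s + r) / fact (2*l + 2*n - 1 + r)) / 2 ^ s) =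
      (fact (Suc s + r) / fact r * (fact (2*l + 2*n - 1 + Suc s + r) / fact (2*l + 2*n - 1 + r))
        / 2 ^ Suc s :: complex)"
    unfolding b by (simp add: field_simps)
  finally show ?case .
qed simp

text \<open>The first \<open>j\<close> applications of \<open>Ds\<close> return a multiple of
  \<open>M\<close>, and the next one annihilates it.\<close>

lemma Ds_pow_Xs_pow_0:
  assumes "M \<in> monogenics n l" "n \<ge> 1" "j < s"
  shows "(Ds n ^^ s) ((Xs n ^^ j) M) = 0"
proof -
  obtain t where s: "s = Suc t + j"
    using less_imp_Suc_add[OF assms(3)] by auto
  have "(Ds n ^^ j) ((Xs n ^^ (j + 0)) M) = scal (fact j * (fact (2*l + 2*n - 1 + j)
      / fact (2*l + 2*n - 1)) / 2 ^ j) M"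
    using Ds_pow_Xs_pow[OF assms(1,2), of j 0] by simp
  then show ?thesis
    using assms(1) by (simp only: s funpow_add funpow_Suc_right o_apply)
      (simp add: clin_scal[OF clin_Ds] clin_0[OF clin_pow[OF clin_Ds]] monogenics_def)
qed

section \<open>Alternating binomial sums and the coefficients of the projections\<close>

text \<open>Pascal's rule on \<open>d choose t\<close> rewrites the sum as one of order
  \<open>d - 1\<close> over first differences. These vanish for \<open>r = 0\<close>; otherwise
  Pascal's rule on the other binomial lowers \<open>r\<close> by one, so \<open>r < d\<close>
  persists. The offset \<open>b + d\<close> keeps the subtraction of \<open>t\<close> exact.\<close>

lemma alternating_sum_binomial:
  assumes "r < d"
  shows "(\<Sum>t\<le>d. (-1) ^ t * of_nat (d choose t) * of_nat ((b + d - t) choose r)) = (0 :: 'a :: comm_ring_1)"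
  using assms
proof (induction d arbitrary: b r)
  case (Suc d)
  let ?f = "\<lambda>t. of_nat ((b + Suc d - t) choose r) :: 'a"
  have "(\<Sum>t\<le>Suc d. (-1) ^ t * of_nat (Suc d choose t) * ?f t) =
      ?f 0 + (\<Sum>t\<le>d. (-1) ^ Suc t * (of_nat (d choose Suc t) + of_nat (d choose t)) * ?f (Suc t))"
    by (subst sum.atMost_Suc_shift) (simp add: add.commute)
  also have "\<dots> = (?f 0 + (\<Sum>t\<le>d. (-1) ^ Suc t * of_nat (d choose Suc t) * ?f (Suc t)))
      - (\<Sum>t\<le>d. (-1) ^ t * of_nat (d choose t) * ?f (Suc t))"
    by (simp only: add_diff_eq[symmetric] sum_subtractf[symmetric])
      (intro arg_cong2[of _ _ _ _ "(+)"] sum.cong refl; simp add: ring_distribs)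
  also have "?f 0 + (\<Sum>t\<le>d. (-1) ^ Suc t * of_nat (d choose Suc t) * ?f (Suc t)) =
      (\<Sum>t\<le>Suc d. (-1) ^ t * of_nat (d choose t) * ?f t)"
    by (subst sum.atMost_Suc_shift) simp
  also have "\<dots> = (\<Sum>t\<le>d. (-1) ^ t * of_nat (d choose t) * ?f t)"
    by (simp add: binomial_eq_0)
  also have "\<dots> - (\<Sum>t\<le>d. (-1) ^ t * of_nat (d choose t) * ?f (Suc t)) =
      (\<Sum>t\<le>d. (-1) ^ t * of_nat (d choose t) * (?f t - ?f (Suc t)))"
    by (simp add: sum_subtractf right_diff_distrib)
  also have "\<dots> = 0"
  proof (cases r)
    case (Suc r')
    have "?f t - ?f (Suc t) = of_nat ((b + d - t) choose r')" if "t \<le> d" for t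
      using that by (simp add: Suc Suc_diff_le)
    then show ?thesis
      using Suc.IH[of r' b] Suc.prems Suc by simp
  qed simp
  finally show ?case .
qed simp

text \<open>Here \<open>d\<close> is the excess \<open>j - i\<close>, and the bracket is the scalar
  produced by \<open>Ds\<close> to the power \<open>i + t\<close>. The powers of 2 cancel; inserting
  \<open>fact d\<close> above and below forms \<open>d choose t\<close> and leaves a prefactor
  independent of \<open>t\<close>.\<close>

lemma a_coeff_mult_factor:
  assumes "n \<ge> 1" "i + d \<le> k" "t \<le> d" and N: "N = 2*n + 2*k - 2*i"
  shows "a_coeff n i k t * (fact (i + d) / fact (d - t) *
      (fact (N + i - d - 1) / fact (N - d - 1 - t)) / 2 ^ (i + t)) =
    (of_nat (N - 1) * fact (i + d) * fact (N + i - d - 1) / (fact i * fact (N + i - 1) * fact d)) *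
      ((-1) ^ t * of_nat (d choose t) * (fact (N - t - 2) / fact (N - d - 1 - t)))"
proof -
  have e: "2*n + 2*k - i - 1 = N + i - 1"
    using assms by linarith
  have b: "(of_nat (d choose t) :: complex) = fact d / (fact t * fact (d - t))"
    using assms(3) by (rule binomial_fact)
  show ?thesis
    unfolding a_coeff_def e b N[symmetric]
    by (simp add: field_simps)
qed

lemma a_coeff_sum:
  assumes "n \<ge> 1" "i + d \<le> k" and N: "N = 2*n + 2*k - 2*i"
  shows "(\<Sum>t\<le>d. a_coeff n i k t * (fact (i + d) / fact (d - t) *
      (fact (N + i - d - 1) / fact (N - d - 1 - t)) / 2 ^ (i + t))) = (if d = 0 then 1 else 0)"
    (is "?S = _")
proof -
  let ?K = "of_nat (N - 1) * fact (i + d) * fact (N + i - d - 1) /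
      (fact i * fact (N + i - 1) * fact d) :: complex"
  let ?g = "\<lambda>t. (-1) ^ t * of_nat (d choose t) * (fact (N - t - 2) / fact (N - d - 1 - t)) :: complex"
  have S: "?S = ?K * (\<Sum>t\<le>d. ?g t)"
    unfolding sum_distrib_left
    by (intro sum.cong refl a_coeff_mult_factor) (use assms in auto)
  show ?thesis
  proof (cases d)
    case 0
    \<comment> \<open>For \<open>d = 0\<close> the prefactor is \<open>N - 1\<close> and the sum is
      \<open>fact (N - 2) / fact (N - 1)\<close>; their product is 1 because \<open>N\<close> is at
      least 2.\<close>
    obtain c where "N = Suc (Suc c)"
      using assms by (intro that[of "N - 2"]) linarith
    with 0 show ?thesis
      unfolding S by (simp add: fact_Suc[of c] del: fact_Suc of_nat_Suc)
  next
    case (Suc r)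
    have "2 + 2*d \<le> N"
      using assms by linarith
    \<comment> \<open>With \<open>b = N - 2 - d\<close>, the quotient of factorials is
      \<open>fact r\<close> times \<open>(b + d - t) choose r\<close>, where
      \<open>r = d - 1\<close>. The bound \<open>d \<le> b\<close> keeps the upper index above
      \<open>r\<close> for every \<open>t \<le> d\<close>.\<close>
    then obtain b where "N = 2 + d + b" "d \<le> b"
      by (metis add.assoc add_le_cancel_left le_Suc_ex mult_2)
    then have "N - t - 2 = b + d - t" "N - d - 1 - t = b + d - t - r" "r \<le> b + d - t" if "t \<le> d" for t
      using that Suc by simp_all
    then have "?g t = fact r * ((-1) ^ t * of_nat (d choose t) * of_nat ((b + d - t) choose r))"
      if "t \<le> d" for t
      using that by (simp add: binomial_fact mult.assoc)
    then have "(\<Sum>t\<le>d. ?g t) =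
        fact r * (\<Sum>t\<le>d. (-1) ^ t * of_nat (d choose t) * of_nat ((b + d - t) choose r))"
      unfolding sum_distrib_left by (intro sum.cong) auto
    also have "\<dots> = 0"
      using alternating_sum_binomial[of r d b] Suc by simp
    finally show ?thesis
      unfolding S using Suc by simp
  qed
qed

section \<open>The projections on the Fischer components\<close>

theorem theorem5p7:
  fixes n k i j :: nat and M :: ctensor
  assumes "n \<ge> 1" and "i \<in> {0..k}" and "j \<in> {0..k}"
    and "M \<in> monogenics n (k - j)"
  shows "pi_op n i k ((Xs n ^^ j) M) = (if i = j then (Xs n ^^ i) M else 0)"
proof (cases "j < i")
  case True
  then show ?thesis
    unfolding pi_op_def
    by (simp add: Ds_pow_Xs_pow_0[OF assms(4,1)] clin_0[OF clin_pow[OF clin_Xs]])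
next
  case False
  define d where "d = j - i"
  define N where "N = 2*n + 2*k - 2*i"
  have j: "j = i + d" and d: "i + d \<le> k"
    using False assms(3) by (auto simp: d_def)
  let ?c = "\<lambda>t. fact (i + d) / fact (d - t) *
      (fact (N + i - d - 1) / fact (N - d - 1 - t)) / 2 ^ (i + t) :: complex"
  \<comment> \<open>\<open>Ds\<close> lowers the power of \<open>Xs\<close> by \<open>i + t\<close>
    and \<open>Xs\<close> restores it, so all summands are multiples of the same vector and only a
    scalar sum remains.\<close>
  have summand: "(Xs n ^^ (i + t)) ((Ds n ^^ (i + t)) ((Xs n ^^ j) M)) = scal (?c t) ((Xs n ^^ j) M)"
    if t: "t \<le> d" for t
  proof -
    have e: "(i + t) + (d - t) = j" "2*(k-j) + 2*n - 1 + (i + t) + (d - t) = N + i - d - 1"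
      "2*(k-j) + 2*n - 1 + (d - t) = N - d - 1 - t"
      using t d assms(1) by (simp_all add: j N_def)
    have "(Ds n ^^ (i + t)) ((Xs n ^^ j) M) = scal (?c t) ((Xs n ^^ (d - t)) M)"
      using Ds_pow_Xs_pow[OF assms(4,1), of "i + t" "d - t", unfolded e] by (simp only: j)
    moreover have "(Xs n ^^ j) M = (Xs n ^^ (i + t)) ((Xs n ^^ (d - t)) M)"
      by (simp only: e(1)[symmetric] funpow_add o_apply)
    ultimately show ?thesis
      by (simp only: clin_scal[OF clin_pow[OF clin_Xs]])
  qed
  have "pi_op n i k ((Xs n ^^ j) M) =
      (\<Sum>t\<le>d. scal (a_coeff n i k t) ((Xs n ^^ (i + t)) ((Ds n ^^ (i + t)) ((Xs n ^^ j) M))))"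
    unfolding pi_op_def
    \<comment> \<open>For \<open>t > d\<close> the power \<open>i + t\<close> of \<open>Ds\<close>
      exceeds \<open>j\<close>, so these summands vanish.\<close>
    by (rule sum.mono_neutral_right)
      (use d in \<open>auto simp: j Ds_pow_Xs_pow_0[OF assms(4,1), unfolded j] clin_0[OF clin_pow[OF clin_Xs]]\<close>)
  also have "\<dots> = (\<Sum>t\<le>d. scal (a_coeff n i k t * ?c t) ((Xs n ^^ j) M))"
    by (intro sum.cong refl) (simp only: summand atMost_iff cvec.scale_scale)
  also have "\<dots> = scal (\<Sum>t\<le>d. a_coeff n i k t * ?c t) ((Xs n ^^ j) M)"
    by (rule cvec.scale_sum_left[symmetric])
  also have "\<dots> = scal (if d = 0 then 1 else 0) ((Xs n ^^ j) M)"
    by (simp only: a_coeff_sum[OF assms(1) d N_def])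
  also have "\<dots> = (if i = j then (Xs n ^^ i) M else 0)"
    by (auto simp: j)
  finally show ?thesis .
qed

end
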